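(* Given a graph $G$ let $G^{(t)}$ be the graph with $V(G^{(t)})=V(G)$ and $E(G^{(t)})=\big\{\{u,v\}\mid\dist_G(u,v)=t\big\}$. If $S=B_1\oplus \cdots\oplus B_\ell$ is \emph{simultaneously} a similarity matrix for $G_1^{(t)}$ and $G_2^{(t)}$ for the matrix $L^{(0)}$ (adjacency matrix) for $t=0,1,2,\ldots$, then for the similarity vertex partitioning $V_1,\ldots,V_\ell$ the graphs $\displaystyle G_1\circ_{i=1}^\ell{}_{V_i}H_i$ and $\displaystyle G_2\circ_{i=1}^\ell{}_{V_i}H_i$ are cospectral for the $\mathcal{D}^f$ (generalized distance) matrix for any choice of $H_1,\ldots,H_\ell$ and any choice of function $f$.
   Context: All graphs are simple, undirected, and connected (including the rooted graphs $H_i$). For $f:\{0,1,\ldots\}\to\mathbb{R}$, the generalized distance matrix $\mathcal{D}^f_G$ has $(u,v)$ entry $f(\dist_G(u,v))$. $L^{(0)}$ denotes the adjacency matrix. $S$ is an invertible block diagonal matrix $B_1\oplus\cdots\oplus B_\ell$, and the similarity vertex partitioning $V_1,\ldots,V_\ell$ assigns to $V_i$ the vertices indexing the rows of block $B_i$. Given rooted graphs $H_1,\ldots,H_\ell$, $\displaystyle G\circ_{i=1}^\ell{}_{V_i}H_i$ denotes the graph obtained from the disjoint union of $G$ and, for each $i$ and each $v\in V_i$, a separate copy of $H_i$, by identifying the root of that copy of $H_i$ with $v$. *)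

theory Defs
  imports
    Complex_Main
    "Graph_Theory.Pair_Digraph"
    "Graph_Theory.Digraph_Component"
    "Jordan_Normal_Form.Char_Poly"
begin

text \<open>
  An undirected edge is represented by its two opposite arcs: a \<^term>\<open>pair_graph\<close> is finite,
  symmetric and has neither loops nor parallel arcs. Connectedness includes non-emptiness.
\<close>

definition connected_simple_graph :: "'a pair_pre_digraph \<Rightarrow> bool" where
  "connected_simple_graph G \<longleftrightarrow> pair_graph G \<and> Digraph_Component.connected (with_proj G)"

text \<open>Meaningful only if some walk joins the two vertices; \<open>LEAST\<close> is unspecified otherwise.\<close>

definition graph_dist :: "'a pair_pre_digraph \<Rightarrow> 'a \<Rightarrow> 'a \<Rightarrow> nat" where
  "graph_dist G u v = (LEAST k. \<exists>p. pre_digraph.awalk (with_proj G) u p v \<and> length p = k)"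

text \<open>For \<open>t = 0\<close> the edges \<open>{u, v}\<close> with \<open>dist u v = 0\<close> are exactly the loops.\<close>

definition distance_graph :: "nat \<Rightarrow> 'a pair_pre_digraph \<Rightarrow> 'a pair_pre_digraph" where
  "distance_graph t G =
     \<lparr> pverts = pverts G,
       parcs = {(u, v). u \<in> pverts G \<and> v \<in> pverts G \<and> graph_dist G u v = t} \<rparr>"

text \<open>The rows and columns of graph matrices are indexed along an enumeration of the vertices.\<close>

definition vertex_enum :: "'a pair_pre_digraph \<Rightarrow> 'a list \<Rightarrow> bool" where
  "vertex_enum G vs \<longleftrightarrow> distinct vs \<and> set vs = pverts G"

definition adjacency_matrix :: "'a pair_pre_digraph \<Rightarrow> 'a list \<Rightarrow> complex mat" where
  "adjacency_matrix G vs =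
     mat (length vs) (length vs) (\<lambda>(i, j). if (vs ! i, vs ! j) \<in> parcs G then 1 else 0)"

definition gen_dist_matrix ::
    "(nat \<Rightarrow> real) \<Rightarrow> 'a pair_pre_digraph \<Rightarrow> 'a list \<Rightarrow> real mat" where
  "gen_dist_matrix f G vs =
     mat (length vs) (length vs) (\<lambda>(i, j). f (graph_dist G (vs ! i) (vs ! j)))"

text \<open>Eigenvalues counted with algebraic multiplicity.\<close>

definition spectrum_mset :: "real mat \<Rightarrow> complex multiset" where
  "spectrum_mset A = proots (char_poly (map_mat complex_of_real A))"

text \<open>
  The spectrum does not depend on the enumeration of the vertices, so all enumerations are
  quantified over; they exist because the graphs of interest are finite.
\<close>

definition gen_dist_cospectral ::
    "(nat \<Rightarrow> real) \<Rightarrow> 'a pair_pre_digraph \<Rightarrow> 'b pair_pre_digraph \<Rightarrow> bool" where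
  "gen_dist_cospectral f G G' \<longleftrightarrow>
     (\<forall>vs vs'. vertex_enum G vs \<longrightarrow> vertex_enum G' vs' \<longrightarrow>
        spectrum_mset (gen_dist_matrix f G vs) = spectrum_mset (gen_dist_matrix f G' vs'))"

text \<open>\<open>S\<close> is invertible and \<open>A = S B S\<^sup>-\<^sup>1\<close>; the witness \<open>Q\<close> is the inverse of \<open>S\<close>.\<close>

definition similarity_matrix :: "complex mat \<Rightarrow> complex mat \<Rightarrow> complex mat \<Rightarrow> bool" where
  "similarity_matrix S A B \<longleftrightarrow> (\<exists>Q. similar_mat_wit A B S Q)"

text \<open>
  The vertices, in the enumeration \<open>vs\<close>, that index the rows of the \<open>i\<close>-th block of
  \<^term>\<open>diag_block_mat Bs\<close> (blocks are numbered from 0).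
\<close>

definition block_part :: "complex mat list \<Rightarrow> 'a list \<Rightarrow> nat \<Rightarrow> 'a set" where
  "block_part Bs vs i =
     {vs ! k | k. (\<Sum>j<i. dim_row (Bs ! j)) \<le> k \<and> k < (\<Sum>j<Suc i. dim_row (Bs ! j))}"

text \<open>
  Gluing, for each \<open>i < l\<close> and each \<open>v \<in> V i\<close>, a copy of \<open>H i\<close> to \<open>G\<close> by identifying its root
  \<open>r i\<close> with \<open>v\<close>. The pair \<open>(v, a)\<close> is the vertex \<open>a\<close> of the copy attached at \<open>v\<close>; in particular
  \<open>(v, r i)\<close> is the vertex \<open>v\<close> of \<open>G\<close> itself.
\<close>

definition coalescence ::
    "'a pair_pre_digraph \<Rightarrow> nat \<Rightarrow> (nat \<Rightarrow> 'a set) \<Rightarrow> (nat \<Rightarrow> 'b pair_pre_digraph) \<Rightarrow> (nat \<Rightarrow> 'b)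
       \<Rightarrow> ('a \<times> 'b) pair_pre_digraph" where
  "coalescence G l V H r =
     \<lparr> pverts = {(v, a) | v a i. i < l \<and> v \<in> V i \<and> a \<in> pverts (H i)},
       parcs =
         {((v, r i), (w, r j)) | v w i j. i < l \<and> j < l \<and> v \<in> V i \<and> w \<in> V j \<and> (v, w) \<in> parcs G}
         \<union> {((v, a), (v, b)) | v a b i. i < l \<and> v \<in> V i \<and> (a, b) \<in> parcs (H i)} \<rparr>"

end

theory Submission
  imports Defs
begin

text \<open>
  Let \<open>d\<close> be the distance of \<open>G\<^sub>1\<close> or \<open>G\<^sub>2\<close>. Since \<open>S\<close> intertwines the adjacency matrices of all
  distance graphs, it intertwines \<open>(g (d u v))\<^bsub>u,v\<^esub>\<close> for every function \<open>g\<close>. In the coalescence,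
  \<open>(v, a)\<close> and \<open>(w, b)\<close> with \<open>v \<noteq> w\<close> have distance \<open>\<alpha> + d v w + \<beta>\<close>, where \<open>\<alpha>\<close> and \<open>\<beta>\<close> are the
  distances of \<open>a\<close> and \<open>b\<close> to the roots of their copies. So, taking \<open>g t = f (\<alpha> + t + \<beta>)\<close> for \<open>t > 0\<close>
  and \<open>g 0 = 0\<close>, the direct sum of the matrices \<open>B\<^sub>i \<otimes> I\<close>, with \<open>I\<close> indexed by the vertices
  of \<open>H\<^sub>i\<close>, intertwines the two generalized distance matrices; the entries with \<open>v = w\<close>
  depend only on the block of \<open>v\<close>, hence match as well.
\<close>

section \<open>Distances via powers of the arc relation\<close>

lemma ex_awalk_iff_relpow:
  assumes "u \<in> pverts G"
  shows "(\<exists>p. pre_digraph.awalk (with_proj G) u p v \<and> length p = k) \<longleftrightarrow> (u, v) \<in> parcs G ^^ k"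
proof -
  have "(\<exists>p. set p \<subseteq> parcs G \<and> pcas u p v \<and> length p = k) \<longleftrightarrow> (u, v) \<in> parcs G ^^ k" for u
  proof (induction k arbitrary: u)
    case 0
    show ?case by auto
  next
    case (Suc k)
    have "(\<exists>p. set p \<subseteq> parcs G \<and> pcas u p v \<and> length p = Suc k) \<longleftrightarrow>
      (\<exists>e p. set (e # p) \<subseteq> parcs G \<and> pcas u (e # p) v \<and> length p = k)"
      by (metis length_Suc_conv)
    also have "\<dots> \<longleftrightarrow> (\<exists>w. (u, w) \<in> parcs G \<and> (\<exists>p. set p \<subseteq> parcs G \<and> pcas w p v \<and> length p = k))"
      by auto
    also have "\<dots> \<longleftrightarrow> (u, v) \<in> parcs G ^^ Suc k"
      unfolding Suc.IH by (blast intro: relpow_Suc_I2 dest: relpow_Suc_D2)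
    finally show ?case .
  qed
  then show ?thesis
    using assms by (simp add: pre_digraph.awalk_def cas_with_proj_eq)
qed

lemma graph_dist_eq_Least:
  "u \<in> pverts G \<Longrightarrow> graph_dist G u v = (LEAST k. (u, v) \<in> parcs G ^^ k)"
  by (simp add: graph_dist_def ex_awalk_iff_relpow)

lemma graph_dist_self [simp]: "u \<in> pverts G \<Longrightarrow> graph_dist G u u = 0"
  by (simp add: graph_dist_eq_Least)

lemma graph_dist_le: "u \<in> pverts G \<Longrightarrow> (u, v) \<in> parcs G ^^ k \<Longrightarrow> graph_dist G u v \<le> k"
  by (simp add: graph_dist_eq_Least Least_le)

text \<open>A potential \<open>\<phi>\<close> that is 0 at \<open>u\<close> and grows by at most one
  along each arc bounds the length of every walk from \<open>u\<close> to \<open>v\<close> from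
  below; the given walk attains the bound.\<close>

lemma graph_dist_eqI:
  assumes "u \<in> pverts G" and "(u, v) \<in> parcs G ^^ \<phi> v" and "\<phi> u = (0::nat)"
    and step: "\<And>x y. (x, y) \<in> parcs G \<Longrightarrow> \<phi> y \<le> Suc (\<phi> x)"
  shows "graph_dist G u v = \<phi> v"
proof -
  have "\<phi> x \<le> k" if "(u, x) \<in> parcs G ^^ k" for x k
    using that
  proof (induction k arbitrary: x)
    case (Suc k)
    then obtain y where "(u, y) \<in> parcs G ^^ k" "(y, x) \<in> parcs G" by auto
    with Suc.IH step show ?case by fastforce
  qed (use assms in auto)
  then show ?thesis
    unfolding graph_dist_eq_Least[OF assms(1)] using assms(2) by (intro Least_equality)
qed

lemma relpow_map:
  assumes "\<And>x y. (x, y) \<in> R \<Longrightarrow> (h x, h y) \<in> R'" and "(x, y) \<in> R ^^ k"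
  shows "(h x, h y) \<in> R' ^^ k"
  using assms(2) by (induction k arbitrary: y) (use assms(1) in auto)

lemma connected_simple_graph_arcD:
  assumes "connected_simple_graph G" and "(x, y) \<in> parcs G"
  shows "x \<in> pverts G" and "y \<in> pverts G"
proof -
  interpret pair_graph G using assms(1) by (simp add: connected_simple_graph_def)
  show "x \<in> pverts G" "y \<in> pverts G" using in_arcsD1 in_arcsD2 assms(2) by auto
qed

text \<open>Connectedness provides a walk, so \<open>LEAST\<close> is attained: it means strong
  connectedness of the symmetric closure, and the arcs are already symmetric.\<close>

lemma graph_dist_relpow:
  assumes G: "connected_simple_graph G" and u: "u \<in> pverts G" and v: "v \<in> pverts G"
  shows "(u, v) \<in> parcs G ^^ graph_dist G u v"
proof -
  interpret pair_graph G using G by (simp add: connected_simple_graph_def)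
  have "strongly_connected (mk_symmetric (with_proj G))"
    using G by (simp add: connected_simple_graph_def connected_def)
  then have "u \<rightarrow>\<^sup>*\<^bsub>mk_symmetric (with_proj G)\<^esub> v"
    using u v by (auto simp: strongly_connected_def)
  then have "u \<rightarrow>\<^sup>*\<^bsub>with_proj G\<^esub> v"
    by (simp add: reachable_mk_symmetric_eq[OF pair_sym_arcs])
  then obtain p where "awalk u p v"
    unfolding reachable_awalk by blast
  then have "\<exists>k. (u, v) \<in> parcs G ^^ k"
    using ex_awalk_iff_relpow[OF u, of v "length p"] by blast
  then show ?thesis
    unfolding graph_dist_eq_Least[OF u] by (rule LeastI_ex)
qed

lemma graph_dist_eq_0_iff:
  assumes "connected_simple_graph G" and "u \<in> pverts G" and "v \<in> pverts G"
  shows "graph_dist G u v = 0 \<longleftrightarrow> u = v"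
  using graph_dist_relpow[OF assms] assms(2) by auto

text \<open>Extending a shortest walk to \<open>x\<close> by the arc gives the bound; it makes
  distances usable as potentials in \<open>graph_dist_eqI\<close>.\<close>

lemma graph_dist_arc:
  assumes "connected_simple_graph G" and "u \<in> pverts G" and "(x, y) \<in> parcs G"
  shows "graph_dist G u y \<le> Suc (graph_dist G u x)"
proof -
  have "(u, x) \<in> parcs G ^^ graph_dist G u x"
    using assms by (blast intro: graph_dist_relpow dest: connected_simple_graph_arcD)
  with assms show ?thesis by (intro graph_dist_le) auto
qed

section \<open>Distances in a coalescence\<close>

context
  fixes G :: "'a pair_pre_digraph" and H :: "nat \<Rightarrow> 'b pair_pre_digraph"
    and V :: "nat \<Rightarrow> 'a set" and r :: "nat \<Rightarrow> 'b" and l :: nat and c :: "'a \<Rightarrow> nat"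
  assumes G: "connected_simple_graph G"
    and H: "\<And>i. i < l \<Longrightarrow> connected_simple_graph (H i) \<and> r i \<in> pverts (H i)"
    and V: "\<And>i. i < l \<Longrightarrow> V i = {v \<in> pverts G. c v = i}"
    and c: "\<And>v. v \<in> pverts G \<Longrightarrow> c v < l"
begin

text \<open>Each vertex lies in exactly one part, so the index quantified in
  \<open>coalescence\<close> can be eliminated; the free \<open>P\<close> lets this rewrite longer
  conjunctions.\<close>

lemma mem_part_iff: "i < l \<and> v \<in> V i \<and> P \<longleftrightarrow> v \<in> pverts G \<and> i = c v \<and> P"
  using V c by auto

lemma pverts_coalescence:
  "pverts (coalescence G l V H r) = (SIGMA v:pverts G. pverts (H (c v)))"
  unfolding coalescence_def pair_pre_digraph.simps mem_part_iff by auto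

lemma parcs_coalescence:
  "parcs (coalescence G l V H r) =
     (\<lambda>(v, w). ((v, r (c v)), (w, r (c w)))) ` parcs G \<union>
     {((v, a), (v, b)) | v a b. v \<in> pverts G \<and> (a, b) \<in> parcs (H (c v))}"
proof -
  have root: "i < l \<and> j < l \<and> v \<in> V i \<and> w \<in> V j \<and> (v, w) \<in> parcs G \<longleftrightarrow>
      i = c v \<and> j = c w \<and> (v, w) \<in> parcs G" for i j v w
    using V c connected_simple_graph_arcD[OF G] by auto
  have "{((v, r i), (w, r j)) | v w i j. i = c v \<and> j = c w \<and> (v, w) \<in> parcs G} =
      (\<lambda>(v, w). ((v, r (c v)), (w, r (c w)))) ` parcs G"
    by (auto simp: image_iff)
  then show ?thesis
    unfolding coalescence_def pair_pre_digraph.simps root mem_part_iff by auto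
qed

text \<open>Copies are attached only at their roots. Walks in the copies and in \<open>G\<close>
  concatenate to the upper bound; a potential gives the lower bound.\<close>

lemma graph_dist_coalescence:
  assumes v: "v \<in> pverts G" and w: "w \<in> pverts G"
    and a: "a \<in> pverts (H (c v))" and b: "b \<in> pverts (H (c w))"
  shows "graph_dist (coalescence G l V H r) (v, a) (w, b) =
    (if v = w then graph_dist (H (c v)) a b
     else graph_dist (H (c v)) a (r (c v)) + graph_dist G v w + graph_dist (H (c w)) (r (c w)) b)"
proof -
  let ?C = "coalescence G l V H r"
  \<comment> \<open>The claimed distance as a function of the endpoint, used as the potential. Its
    two branches agree at the root \<open>(v, r (c v))\<close>.\<close>
  define \<phi> where "\<phi> = (\<lambda>(w, b). if v = w then graph_dist (H (c v)) a b
     else graph_dist (H (c v)) a (r (c v)) + graph_dist G v w + graph_dist (H (c w)) (r (c w)) b)"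
  note cH = H[OF c, THEN conjunct1] and rH = H[OF c, THEN conjunct2]
  have walk_H: "((x, d), (x, e)) \<in> parcs ?C ^^ graph_dist (H (c x)) d e"
    if "x \<in> pverts G" "d \<in> pverts (H (c x))" "e \<in> pverts (H (c x))" for x d e
    using that by (intro relpow_map[OF _ graph_dist_relpow[OF cH]]) (auto simp: parcs_coalescence)
  have walk_G: "((v, r (c v)), (w, r (c w))) \<in> parcs ?C ^^ graph_dist G v w"
    using v w by (intro relpow_map[OF _ graph_dist_relpow[OF G], where h = "\<lambda>v. (v, r (c v))"])
      (auto simp: parcs_coalescence)
  have walk: "((v, a), (w, b)) \<in> parcs ?C ^^ \<phi> (w, b)"
  proof (cases "v = w")
    case True
    then show ?thesis using walk_H[of v a b] assms by (simp add: \<phi>_def)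
  next
    case False
    then show ?thesis
      using walk_H[of v a "r (c v)"] walk_G walk_H[of w "r (c w)" b] assms rH
      by (auto simp: \<phi>_def relpow_add)
  qed
  \<comment> \<open>An arc of \<open>G\<close> joins roots and affects only the distance in
    \<open>G\<close>; an arc of a copy affects only the distance inside that copy.\<close>
  have step: "\<phi> q \<le> Suc (\<phi> p)" if "(p, q) \<in> parcs ?C" for p q
    using that unfolding parcs_coalescence
  proof
    assume "(p, q) \<in> (\<lambda>(v, w). ((v, r (c v)), (w, r (c w)))) ` parcs G"
    then obtain x y where "(x, y) \<in> parcs G" "p = (x, r (c x))" "q = (y, r (c y))" by auto
    moreover from this have "x \<in> pverts G" "y \<in> pverts G"
      using connected_simple_graph_arcD[OF G] by auto
    ultimately show ?thesis
      using graph_dist_arc[OF G v, of x y] v by (auto simp: \<phi>_def rH)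
  next
    assume "(p, q) \<in> {((v, a), (v, b)) | v a b. v \<in> pverts G \<and> (a, b) \<in> parcs (H (c v))}"
    then obtain x d e where "x \<in> pverts G" "(d, e) \<in> parcs (H (c x))" "p = (x, d)" "q = (x, e)"
      by auto
    then show ?thesis
      using graph_dist_arc[OF cH, of x _ d e] a by (auto simp: \<phi>_def rH)
  qed
  have "graph_dist ?C (v, a) (w, b) = \<phi> (w, b)"
    using walk step v a by (intro graph_dist_eqI) (auto simp: pverts_coalescence \<phi>_def)
  then show ?thesis by (simp add: \<phi>_def)
qed

end

section \<open>Equal spectra from an intertwining matrix\<close>

text \<open>Summing over sets of indices frees later arguments from positions. Equal lengths make
  \<open>T\<close> square, so its right inverse is two-sided and the intertwining relation is a
  similarity.\<close>

lemma spectrum_mset_eqI: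
  fixes M :: "'x \<Rightarrow> 'x \<Rightarrow> real" and N :: "'y \<Rightarrow> 'y \<Rightarrow> real"
    and T :: "'x \<Rightarrow> 'y \<Rightarrow> complex" and Q :: "'y \<Rightarrow> 'x \<Rightarrow> complex"
  assumes xs: "distinct xs" and ys: "distinct ys" and len: "length xs = length ys"
    and inverse: "\<And>x x'. x \<in> set xs \<Longrightarrow> x' \<in> set xs \<Longrightarrow>
      (\<Sum>y\<in>set ys. T x y * Q y x') = (if x = x' then 1 else 0)"
    and intertwine: "\<And>x y. x \<in> set xs \<Longrightarrow> y \<in> set ys \<Longrightarrow>
      (\<Sum>x'\<in>set xs. complex_of_real (M x x') * T x' y) =
      (\<Sum>y'\<in>set ys. T x y' * complex_of_real (N y' y))"
  shows "spectrum_mset (mat (length xs) (length xs) (\<lambda>(i, j). M (xs ! i) (xs ! j))) =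
    spectrum_mset (mat (length ys) (length ys) (\<lambda>(i, j). N (ys ! i) (ys ! j)))"
proof -
  define n where "n = length ys"
  define A where "A = mat n n (\<lambda>(i, j). complex_of_real (M (xs ! i) (xs ! j)))"
  define B where "B = mat n n (\<lambda>(i, j). complex_of_real (N (ys ! i) (ys ! j)))"
  define P where "P = mat n n (\<lambda>(i, j). T (xs ! i) (ys ! j))"
  define R where "R = mat n n (\<lambda>(i, j). Q (ys ! i) (xs ! j))"
  have carrier: "A \<in> carrier_mat n n" "B \<in> carrier_mat n n" "P \<in> carrier_mat n n" "R \<in> carrier_mat n n"
    by (auto simp: A_def B_def P_def R_def)
  have sum_nth: "(\<Sum>k = 0..<n. g (zs ! k)) = sum g (set zs)"
    if "distinct zs" "length zs = n" for g :: "'z \<Rightarrow> complex" and zs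
    using that by (intro sum.reindex_bij_betw bij_betw_nth) auto
  have PR: "P * R = 1\<^sub>m n"
    using xs len by (intro eq_matI)
      (auto simp: P_def R_def scalar_prod_def n_def[symmetric] inverse nth_eq_iff_index_eq
         sum_nth[OF ys n_def[symmetric], of "\<lambda>y. T _ y * Q y _"])
  have AP: "A * P = P * B"
    using len intertwine by (intro eq_matI)
      (auto simp: A_def P_def B_def scalar_prod_def n_def[symmetric]
         sum_nth[OF ys n_def[symmetric], of "\<lambda>y. T _ y * of_real (N y _)"]
         sum_nth[OF xs len[folded n_def], of "\<lambda>x. of_real (M _ x) * T x _"])
  have "A = (A * P) * R"
    using carrier by (simp add: assoc_mult_mat[of _ n n _ n _ n] PR)
  then have "similar_mat A B"
    unfolding AP using carrier PR mat_mult_left_right_inverse[OF _ _ PR]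
    by (intro similar_matI[of A B P R n]) auto
  moreover have "A = map_mat complex_of_real (mat (length xs) (length xs) (\<lambda>(i, j). M (xs ! i) (xs ! j)))"
    "B = map_mat complex_of_real (mat (length ys) (length ys) (\<lambda>(i, j). N (ys ! i) (ys ! j)))"
    by (auto simp: A_def B_def n_def len)
  ultimately show ?thesis
    unfolding spectrum_mset_def by (metis char_poly_similar)
qed

section \<open>Block indices and entries of a block diagonal matrix\<close>

lemma block_index_exists:
  fixes d :: "nat \<Rightarrow> nat"
  assumes "k < (\<Sum>j<l. d j)"
  shows "\<exists>i<l. (\<Sum>j<i. d j) \<le> k \<and> k < (\<Sum>j<Suc i. d j)"
  using assms
proof (induction l)
  case (Suc l)
  then show ?case
    by (cases "k < (\<Sum>j<l. d j)") (auto simp: less_Suc_eq)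
qed simp

text \<open>Monotonicity of the partial sums: for \<open>i < i'\<close> the upper bound on
  \<open>k\<close> from \<open>i\<close> is at most the lower bound from \<open>i'\<close>.\<close>

lemma block_index_unique:
  fixes d :: "nat \<Rightarrow> nat"
  assumes "(\<Sum>j<i. d j) \<le> k" "k < (\<Sum>j<Suc i. d j)" "(\<Sum>j<i'. d j) \<le> k" "k < (\<Sum>j<Suc i'. d j)"
  shows "i = i'"
proof (rule ccontr)
  have mono: "(\<Sum>j<a. d j) \<le> (\<Sum>j<b. d j)" if "a \<le> b" for a b
    using that by (intro sum_mono2) auto
  assume "i \<noteq> i'"
  then consider "Suc i \<le> i'" | "Suc i' \<le> i" by linarith
  then show False
    using mono[of "Suc i" i'] mono[of "Suc i'" i] assms by cases linarith+
qed

lemma dim_row_diag_block_mat: "dim_row (diag_block_mat Bs) = (\<Sum>j<length Bs. dim_row (Bs ! j))"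
  by (simp add: dim_diag_block_mat sum_list_sum_nth atLeast0LessThan)

text \<open>Peel off the first block. If exactly one position lies in it, the entry belongs to a
  zero block; if neither does, both shift by its size; \<open>i \<noteq> i'\<close> excludes the
  remaining case. Squareness lets row offsets locate columns as well.\<close>

lemma diag_block_mat_off_block:
  assumes "\<forall>B\<in>set Bs. square_mat B" and "i < length Bs" "i' < length Bs" "i \<noteq> i'"
    and "(\<Sum>j<i. dim_row (Bs ! j)) \<le> k" "k < (\<Sum>j<Suc i. dim_row (Bs ! j))"
    and "(\<Sum>j<i'. dim_row (Bs ! j)) \<le> k'" "k' < (\<Sum>j<Suc i'. dim_row (Bs ! j))"
  shows "diag_block_mat Bs $$ (k, k') = 0"
  using assms
proof (induction Bs arbitrary: i i' k k')
  case (Cons B Bs)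
  let ?D = "diag_block_mat Bs"
  have sq: "dim_col B = dim_row B" "dim_col ?D = dim_row ?D"
    using Cons.prems(1) diag_block_mat_square[of Bs] by auto
  \<comment> \<open>The entry formula for block matrices applies to positions inside the
    matrix.\<close>
  have bound: "k < dim_row B + dim_row ?D"
    if "k < (\<Sum>j<Suc i. dim_row ((B # Bs) ! j))" "i < length (B # Bs)" for k i
  proof -
    have "(\<Sum>j<Suc i. dim_row ((B # Bs) ! j)) \<le> (\<Sum>j<length (B # Bs). dim_row ((B # Bs) ! j))"
      using that(2) by (intro sum_mono2) auto
    with that(1) show ?thesis
      by (simp add: dim_row_diag_block_mat sum.lessThan_Suc_shift del: sum.lessThan_Suc)
  qed
  note bounds = bound[OF Cons.prems(6) Cons.prems(2)] bound[OF Cons.prems(8) Cons.prems(3)]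
  show ?case
  proof (cases "k < dim_row B \<or> k' < dim_row B")
    case True
    moreover have "\<not> (k < dim_row B \<and> k' < dim_row B)"
      using Cons.prems by (cases i; cases i') (auto simp: sum.lessThan_Suc_shift simp del: sum.lessThan_Suc)
    ultimately show ?thesis
      using bounds sq by (auto simp: Let_def)
  next
    case False
    then obtain e e' where "i = Suc e" "i' = Suc e'"
      using Cons.prems by (cases i; cases i') auto
    with False Cons.prems have "?D $$ (k - dim_row B, k' - dim_row B) = 0"
      by (intro Cons.IH[of e e'])
         (auto simp: sum.lessThan_Suc_shift less_diff_conv2 le_diff_conv2 add.commute simp del: sum.lessThan_Suc)
    with False bounds sq show ?thesis
      by (auto simp: Let_def)
  qed
qed simp

section \<open>From single distances to functions of the distance\<close>

text \<open>On finitely many values, \<open>g\<close> is a linear combination of indicators of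
  single values \<open>t\<close> with coefficients \<open>g t\<close>, and the assumed identities
  are linear in the indicators.\<close>

lemma sum_level_sets:
  fixes g :: "nat \<Rightarrow> complex"
  assumes fin: "finite X" "finite Y"
    and levels: "\<And>t. (\<Sum>x\<in>X. of_bool (d x = t) * s x) = (\<Sum>y\<in>Y. s' y * of_bool (e y = t))"
  shows "(\<Sum>x\<in>X. g (d x) * s x) = (\<Sum>y\<in>Y. s' y * g (e y))"
proof -
  \<comment> \<open>\<open>D\<close> contains the values attained on both sides, so one finite
    expansion serves both sums.\<close>
  define D where "D = d ` X \<union> e ` Y"
  have g: "g m = (\<Sum>t\<in>D. g t * of_bool (m = t))" if "m \<in> D" for m
    using that fin by (simp add: D_def of_bool_def if_distrib sum.delta cong: if_cong)
  have "(\<Sum>x\<in>X. g (d x) * s x) = (\<Sum>x\<in>X. \<Sum>t\<in>D. g t * (of_bool (d x = t) * s x))"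
    by (intro sum.cong refl, subst g) (auto simp: D_def sum_distrib_right mult.assoc)
  also have "\<dots> = (\<Sum>t\<in>D. g t * (\<Sum>x\<in>X. of_bool (d x = t) * s x))"
    by (subst sum.swap) (simp add: sum_distrib_left)
  also have "\<dots> = (\<Sum>y\<in>Y. \<Sum>t\<in>D. g t * (s' y * of_bool (e y = t)))"
    unfolding levels by (subst sum.swap) (simp add: sum_distrib_left)
  also have "\<dots> = (\<Sum>y\<in>Y. s' y * g (e y))"
    by (intro sum.cong refl, subst (2) g) (auto simp: D_def sum_distrib_left ac_simps)
  finally show ?thesis .
qed

section \<open>Intertwining the distance matrices of the coalescences\<close>

text \<open>The vertex-indexed form of the theorem: \<open>s\<close> stands for the similarity
  matrix, \<open>q\<close> for its inverse, \<open>c1\<close> and \<open>c2\<close> for the block of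
  a vertex. The bijection \<open>\<pi>\<close> makes corresponding parts, hence the coalescences,
  equally large.\<close>

lemma coalescence_cospectral:
  fixes G1 :: "'a pair_pre_digraph" and G2 :: "'c pair_pre_digraph"
    and H :: "nat \<Rightarrow> 'b pair_pre_digraph"
    and c1 :: "'a \<Rightarrow> nat" and c2 :: "'c \<Rightarrow> nat"
    and s :: "'a \<Rightarrow> 'c \<Rightarrow> complex" and q :: "'c \<Rightarrow> 'a \<Rightarrow> complex"
  assumes G1: "connected_simple_graph G1" and G2: "connected_simple_graph G2"
    and H: "\<And>i. i < l \<Longrightarrow> connected_simple_graph (H i) \<and> r i \<in> pverts (H i)"
    and V1: "\<And>i. i < l \<Longrightarrow> V1 i = {v \<in> pverts G1. c1 v = i}"
    and V2: "\<And>i. i < l \<Longrightarrow> V2 i = {w \<in> pverts G2. c2 w = i}"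
    and c1: "\<And>v. v \<in> pverts G1 \<Longrightarrow> c1 v < l" and c2: "\<And>w. w \<in> pverts G2 \<Longrightarrow> c2 w < l"
    and \<pi>: "bij_betw \<pi> (pverts G1) (pverts G2)" "\<And>v. v \<in> pverts G1 \<Longrightarrow> c2 (\<pi> v) = c1 v"
    and block: "\<And>v w. v \<in> pverts G1 \<Longrightarrow> w \<in> pverts G2 \<Longrightarrow> c1 v \<noteq> c2 w \<Longrightarrow> s v w = 0"
    and inverse: "\<And>v u. v \<in> pverts G1 \<Longrightarrow> u \<in> pverts G1 \<Longrightarrow>
      (\<Sum>w\<in>pverts G2. s v w * q w u) = of_bool (v = u)"
    and intertwine: "\<And>t v w. v \<in> pverts G1 \<Longrightarrow> w \<in> pverts G2 \<Longrightarrow>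
      (\<Sum>u\<in>pverts G1. of_bool (graph_dist G1 v u = t) * s u w) =
      (\<Sum>x\<in>pverts G2. s v x * of_bool (graph_dist G2 x w = t))"
  shows "gen_dist_cospectral f (coalescence G1 l V1 H r) (coalescence G2 l V2 H r)"
  unfolding gen_dist_cospectral_def vertex_enum_def
proof (intro allI impI, elim conjE)
  let ?C1 = "coalescence G1 l V1 H r" and ?C2 = "coalescence G2 l V2 H r"
  fix xs ys assume xs: "distinct xs" "set xs = pverts ?C1" and ys: "distinct ys" "set ys = pverts ?C2"
  \<comment> \<open>The vertex sets of different \<open>H i\<close> may overlap, so
    \<open>a = b\<close> does not imply equal blocks; for different blocks \<open>block\<close>
    makes the entry vanish.\<close>
  define T where "T = (\<lambda>(v, a :: 'b) (w, b). of_bool (a = b) * s v w)"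
  \<comment> \<open>The block condition is imposed explicitly because \<open>q\<close> is not assumed to be block diagonal.\<close>
  define Q where "Q = (\<lambda>(w, b :: 'b) (v, a). of_bool (b = a \<and> c2 w = c1 v) * q w v)"
  have setx: "set xs = (SIGMA v:pverts G1. pverts (H (c1 v)))"
    using xs(2) pverts_coalescence[OF G1 H V1 c1] by simp
  have sety: "set ys = (SIGMA w:pverts G2. pverts (H (c2 w)))"
    using ys(2) pverts_coalescence[OF G2 H V2 c2] by simp
  have finG: "finite (pverts G)" if "connected_simple_graph G" for G :: "'z pair_pre_digraph"
  proof -
    interpret pair_graph G using that by (simp add: connected_simple_graph_def)
    show ?thesis by (rule pair_finite_verts)
  qed
  note fin = finG[OF G1] finG[OF G2]
  have finH: "finite (pverts (H i))" if "i < l" for i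
    using finG H[OF that] by blast
  have sum1: "(\<Sum>x\<in>set xs. h x) = (\<Sum>v\<in>pverts G1. \<Sum>a\<in>pverts (H (c1 v)). h (v, a))" for h :: "_ \<Rightarrow> complex"
    unfolding setx using fin finH c1 by (subst sum.Sigma) auto
  have sum2: "(\<Sum>x\<in>set ys. h x) = (\<Sum>v\<in>pverts G2. \<Sum>a\<in>pverts (H (c2 v)). h (v, a))" for h :: "_ \<Rightarrow> complex"
    unfolding sety using fin finH c2 by (subst sum.Sigma) auto
  have "length xs = (\<Sum>v\<in>pverts G1. card (pverts (H (c1 v))))"
    using fin finH c1 distinct_card[OF xs(1)] by (simp add: setx)
  also have "\<dots> = (\<Sum>v\<in>pverts G1. card (pverts (H (c2 (\<pi> v)))))"
    using \<pi>(2) by simp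
  also have "\<dots> = (\<Sum>w\<in>pverts G2. card (pverts (H (c2 w))))"
    by (rule sum.reindex_bij_betw[OF \<pi>(1)])
  also have "\<dots> = length ys"
    using fin finH c2 distinct_card[OF ys(1)] by (simp add: sety)
  finally have len: "length xs = length ys" .
  have TQ: "(\<Sum>y\<in>set ys. T x y * Q y x') = (if x = x' then 1 else 0)"
    if xx': "x \<in> set xs" "x' \<in> set xs" for x x'
  proof -
    obtain v a u e where x: "x = (v, a)" "x' = (u, e)" by fastforce
    have mem: "v \<in> pverts G1" "a \<in> pverts (H (c1 v))" "u \<in> pverts G1"
      using xx' by (auto simp: x setx)
    \<comment> \<open>Only \<open>b = a\<close> survives. Where \<open>s v w\<close> is nonzero,
      \<open>c2 w = c1 v\<close>, so the block condition in \<open>Q\<close> becomes independent of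
      \<open>w\<close> and factors out of the sum; where it fails,
      \<open>v \<noteq> u\<close>.\<close>
    have "(\<Sum>b\<in>pverts (H (c2 w)). T x (w, b) * Q (w, b) x')
        = of_bool (a = e \<and> c1 v = c1 u) * (s v w * q w u)" if w: "w \<in> pverts G2" for w
    proof (cases "c1 v = c2 w")
      case True
      have "(\<Sum>b\<in>pverts (H (c2 w)). T x (w, b) * Q (w, b) x')
          = (\<Sum>b\<in>pverts (H (c2 w)). if b = a then of_bool (a = e \<and> c1 v = c1 u) * (s v w * q w u) else 0)"
        using True by (intro sum.cong) (auto simp: T_def Q_def x)
      then show ?thesis using finH[OF c2[OF w]] mem True by simp
    qed (use block mem w in \<open>simp add: T_def x\<close>)
    then have "(\<Sum>y\<in>set ys. T x y * Q y x')
        = of_bool (a = e \<and> c1 v = c1 u) * (\<Sum>w\<in>pverts G2. s v w * q w u)"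
      unfolding sum2 by (simp add: sum_distrib_left)
    then show ?thesis using inverse mem by (auto simp: x)
  qed
  have DT: "(\<Sum>x'\<in>set xs. complex_of_real (f (graph_dist ?C1 x x')) * T x' y)
      = (\<Sum>y'\<in>set ys. T x y' * complex_of_real (f (graph_dist ?C2 y' y)))"
    if xy: "x \<in> set xs" "y \<in> set ys" for x y
  proof -
    obtain v a w b where x: "x = (v, a)" "y = (w, b)" by fastforce
    have mem: "v \<in> pverts G1" "a \<in> pverts (H (c1 v))" "w \<in> pverts G2" "b \<in> pverts (H (c2 w))"
      using xy by (auto simp: x setx sety)
    note dist1 = graph_dist_coalescence[OF G1 H V1 c1] and dist2 = graph_dist_coalescence[OF G2 H V2 c2]
    \<comment> \<open>The same two root distances occur on both sides: the surviving vertex is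
      \<open>(u, b)\<close> with \<open>c1 u = c2 w\<close> on the left, and \<open>(u, a)\<close>
      with \<open>c2 u = c1 v\<close> on the right.\<close>
    define g where "g t = (if t = 0 then 0 else complex_of_real (f (graph_dist (H (c1 v)) a (r (c1 v)) + t
      + graph_dist (H (c2 w)) (r (c2 w)) b)))" for t
    \<comment> \<open>The term within a single copy, arising from \<open>u = v\<close> on the left
      and \<open>u = w\<close> on the right. Both agree, since \<open>s v w\<close> vanishes unless
      \<open>c1 v = c2 w\<close>.\<close>
    define z where "z = s v w * complex_of_real (f (graph_dist (H (c1 v)) a b))"
    have g1: "(\<Sum>e\<in>pverts (H (c1 u)). complex_of_real (f (graph_dist ?C1 x (u, e))) * T (u, e) y)
        = g (graph_dist G1 v u) * s u w + (if u = v then z else 0)" if u: "u \<in> pverts G1" for u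
    proof (cases "c1 u = c2 w")
      case True
      have "(\<Sum>e\<in>pverts (H (c1 u)). complex_of_real (f (graph_dist ?C1 x (u, e))) * T (u, e) y)
          = (\<Sum>e\<in>pverts (H (c1 u)). if e = b then complex_of_real (f (graph_dist ?C1 x (u, b))) * s u w else 0)"
        by (intro sum.cong) (auto simp: T_def x)
      also have "\<dots> = complex_of_real (f (graph_dist ?C1 x (u, b))) * s u w"
        using finH[OF c1[OF u]] mem True by simp
      also have "\<dots> = g (graph_dist G1 v u) * s u w + (if u = v then z else 0)"
        using True mem u graph_dist_eq_0_iff[OF G1 mem(1) u]
        by (auto simp: x dist1 g_def z_def)
      finally show ?thesis .
    next
      case False
      then show ?thesis using block mem u by (auto simp: T_def x z_def)
    qed
    have g2: "(\<Sum>e\<in>pverts (H (c2 u)). T x (u, e) * complex_of_real (f (graph_dist ?C2 (u, e) y)))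
        = s v u * g (graph_dist G2 u w) + (if u = w then z else 0)" if u: "u \<in> pverts G2" for u
    proof (cases "c1 v = c2 u")
      case True
      have "(\<Sum>e\<in>pverts (H (c2 u)). T x (u, e) * complex_of_real (f (graph_dist ?C2 (u, e) y)))
          = (\<Sum>e\<in>pverts (H (c2 u)). if e = a then s v u * complex_of_real (f (graph_dist ?C2 (u, a) y)) else 0)"
        by (intro sum.cong) (auto simp: T_def x)
      also have "\<dots> = s v u * complex_of_real (f (graph_dist ?C2 (u, a) y))"
        using finH[OF c2[OF u]] mem True by simp
      also have "\<dots> = s v u * g (graph_dist G2 u w) + (if u = w then z else 0)"
        using True mem u graph_dist_eq_0_iff[OF G2 u mem(3)]
        by (auto simp: x dist2 g_def z_def)
      finally show ?thesis .
    next
      case False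
      then show ?thesis using block mem u by (auto simp: T_def x z_def)
    qed
    show ?thesis
      unfolding sum1 sum2 using fin mem
      by (simp add: g1 g2 sum.distrib sum_level_sets[OF fin intertwine])
  qed
  show "spectrum_mset (gen_dist_matrix f ?C1 xs) = spectrum_mset (gen_dist_matrix f ?C2 ys)"
    unfolding gen_dist_matrix_def
    by (rule spectrum_mset_eqI[where T = T and Q = Q]) (use xs(1) ys(1) len TQ DT in auto)
qed

section \<open>Passing from matrix positions to vertices\<close>

lemma mult_mat_index_bij_betw:
  fixes A B :: "'z::comm_ring_1 mat"
  assumes "A \<in> carrier_mat n n" "B \<in> carrier_mat n n" "i < n" "j < n" and "bij_betw p W {..<n}"
  shows "(A * B) $$ (i, j) = (\<Sum>w\<in>W. A $$ (i, p w) * B $$ (p w, j))"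
  using assms(1-4) sum.reindex_bij_betw[OF assms(5), of "\<lambda>k. A $$ (i, k) * B $$ (k, j)"]
  by (auto simp: scalar_prod_def atLeast0LessThan)

theorem theorem3p4:
  fixes G1 :: "'a pair_pre_digraph" and G2 :: "'c pair_pre_digraph"
    and vs1 :: "'a list" and vs2 :: "'c list"
    and Bs :: "complex mat list"
    and H :: "nat \<Rightarrow> 'b pair_pre_digraph" and r :: "nat \<Rightarrow> 'b"
    and f :: "nat \<Rightarrow> real"
  assumes "connected_simple_graph G1" and "vertex_enum G1 vs1"
    and "connected_simple_graph G2" and "vertex_enum G2 vs2"
    and "\<forall>B \<in> set Bs. square_mat B"
    and "\<forall>t. similarity_matrix (diag_block_mat Bs)
               (adjacency_matrix (distance_graph t G1) vs1)
               (adjacency_matrix (distance_graph t G2) vs2)"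
    and "\<forall>i < length Bs. connected_simple_graph (H i) \<and> r i \<in> pverts (H i)"
  shows "gen_dist_cospectral f
           (coalescence G1 (length Bs) (block_part Bs vs1) H r)
           (coalescence G2 (length Bs) (block_part Bs vs2) H r)"
proof -
  define n where "n = length vs1"
  define S where "S = diag_block_mat Bs"
  define A1 where "A1 t = adjacency_matrix (distance_graph t G1) vs1" for t
  define A2 where "A2 t = adjacency_matrix (distance_graph t G2) vs2" for t
  \<comment> \<open>The witness is obtained for each \<open>t\<close> separately, but always inverts
    the same \<open>S\<close>; \<open>Q 0\<close> is the inverse used below.\<close>
  have "\<exists>Q. similar_mat_wit (A1 t) (A2 t) S Q" for t
    using assms(6) by (simp add: similarity_matrix_def A1_def A2_def S_def)
  then obtain Q where Q: "\<And>t. similar_mat_wit (A1 t) (A2 t) S (Q t)" by metis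
  have dim_A1: "n = dim_row (A1 t)" for t
    by (simp add: A1_def adjacency_matrix_def n_def)
  note wit = similar_mat_witD[OF dim_A1 Q]
  have vs1: "distinct vs1" "set vs1 = pverts G1" and vs2: "distinct vs2" "set vs2 = pverts G2"
    using assms(2,4) by (auto simp: vertex_enum_def)
  have len2: "length vs2 = n"
    using carrier_matD(1)[OF wit(5)[of 0]] by (simp add: A2_def adjacency_matrix_def)
  have n: "n = (\<Sum>j<length Bs. dim_row (Bs ! j))"
    using carrier_matD(1)[OF wit(6)] by (simp add: S_def dim_row_diag_block_mat)
  have commute: "A1 t * S = S * A2 t" for t
  proof -
    have "A1 t * S = S * A2 t * (Q t * S)"
      unfolding wit(3)[of t] using wit(5)[of t] wit(6) wit(7)[of t] by (intro assoc_mult_mat) auto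
    then show ?thesis
      using wit(2)[of t] wit(5)[of t] wit(6) by simp
  qed
  define p1 where "p1 = inv_into {..<n} ((!) vs1)"
  define p2 where "p2 = inv_into {..<n} ((!) vs2)"
  have bij1: "bij_betw ((!) vs1) {..<n} (pverts G1)" and bij2: "bij_betw ((!) vs2) {..<n} (pverts G2)"
    using vs1 vs2 len2 by (auto simp: n_def intro!: bij_betw_nth)
  have p1: "bij_betw p1 (pverts G1) {..<n}" and p2: "bij_betw p2 (pverts G2) {..<n}"
    using bij1 bij2 by (auto simp: p1_def p2_def intro: bij_betw_inv_into)
  have p1_nth: "p1 (vs1 ! k) = k" and p2_nth: "p2 (vs2 ! k) = k" if "k < n" for k
    using that bij1 bij2 by (auto simp: p1_def p2_def bij_betw_inv_into_left)
  have nth_p1: "vs1 ! p1 v = v" if "v \<in> pverts G1" for v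
    using that bij1 by (simp add: p1_def bij_betw_inv_into_right)
  have nth_p2: "vs2 ! p2 v = v" if "v \<in> pverts G2" for v
    using that bij2 by (simp add: p2_def bij_betw_inv_into_right)
  have p1_less: "p1 v < n" if "v \<in> pverts G1" for v
    using that bij_betwE[OF p1] by auto
  have p2_less: "p2 v < n" if "v \<in> pverts G2" for v
    using that bij_betwE[OF p2] by auto
  \<comment> \<open>The premise \<open>k < n\<close> sits under the existential, so that choice
    yields a total function \<open>blk\<close>.\<close>
  have "\<forall>k. \<exists>i. k < n \<longrightarrow> i < length Bs \<and>
      (\<Sum>j<i. dim_row (Bs ! j)) \<le> k \<and> k < (\<Sum>j<Suc i. dim_row (Bs ! j))"
    unfolding n using block_index_exists by blast
  then obtain blk where blk: "\<And>k. k < n \<Longrightarrow> blk k < length Bs \<and>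
      (\<Sum>j<blk k. dim_row (Bs ! j)) \<le> k \<and> k < (\<Sum>j<Suc (blk k). dim_row (Bs ! j))"
    by (elim choice[elim_format] exE) blast
  have blk_iff: "(\<Sum>j<i. dim_row (Bs ! j)) \<le> k \<and> k < (\<Sum>j<Suc i. dim_row (Bs ! j)) \<longleftrightarrow> k < n \<and> blk k = i"
    if "i < length Bs" for i k
  proof -
    have "(\<Sum>j<Suc i. dim_row (Bs ! j)) \<le> n"
      unfolding n using that by (intro sum_mono2) auto
    then show ?thesis
      using blk[of k] block_index_unique[of "\<lambda>j. dim_row (Bs ! j)" i k "blk k"]
      by (blast intro: order_less_le_trans)
  qed
  have part: "block_part Bs vs i = {v \<in> V. blk (p v) = i}"
    if i: "i < length Bs" and "bij_betw ((!) vs) {..<n} V" "\<And>k. k < n \<Longrightarrow> p (vs ! k) = k"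
    for i p and vs :: "'z list" and V
  proof -
    have "V = (!) vs ` {..<n}" using that(2) by (simp add: bij_betw_imp_surj_on)
    then show ?thesis
      unfolding block_part_def blk_iff[OF i] using that(3) by auto
  qed
  \<comment> \<open>\<open>\<pi>\<close> matches vertices at equal positions of the two
    enumerations, so it preserves the block index.\<close>
  show ?thesis
  proof (rule coalescence_cospectral[where
        ?c1.0 = "\<lambda>v. blk (p1 v)" and ?c2.0 = "\<lambda>w. blk (p2 w)" and \<pi> = "\<lambda>v. vs2 ! p1 v"
        and s = "\<lambda>v w. S $$ (p1 v, p2 w)" and q = "\<lambda>w v. Q 0 $$ (p2 w, p1 v)"])
    show "bij_betw (\<lambda>v. vs2 ! p1 v) (pverts G1) (pverts G2)"
      using bij_betw_trans[OF p1 bij2] by (simp add: comp_def)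
    show "S $$ (p1 v, p2 w) = 0"
      if "v \<in> pverts G1" "w \<in> pverts G2" "blk (p1 v) \<noteq> blk (p2 w)" for v w
      using blk[OF p1_less[OF that(1)]] blk[OF p2_less[OF that(2)]] that(3) assms(5)
      unfolding S_def by (intro diag_block_mat_off_block[of Bs "blk (p1 v)" "blk (p2 w)"]) blast+
    show "(\<Sum>w\<in>pverts G2. S $$ (p1 v, p2 w) * Q 0 $$ (p2 w, p1 u)) = of_bool (v = u)"
      if "v \<in> pverts G1" "u \<in> pverts G1" for v u
      using mult_mat_index_bij_betw[OF wit(6) wit(7)[of 0] _ _ p2, of "p1 v" "p1 u"] wit(1)[of 0] that
      by (simp add: p1_less) (metis nth_p1)
    show "(\<Sum>u\<in>pverts G1. of_bool (graph_dist G1 v u = t) * S $$ (p1 u, p2 w)) =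
        (\<Sum>x\<in>pverts G2. S $$ (p1 v, p2 x) * of_bool (graph_dist G2 x w = t))"
      if "v \<in> pverts G1" "w \<in> pverts G2" for t v w
    proof -
      \<comment> \<open>The adjacency matrix of the distance graph is the indicator of distance
        \<open>t\<close>, so \<open>commute\<close> supplies the intertwining relation level by
        level.\<close>
      have "A1 t $$ (p1 v, p1 u) = of_bool (graph_dist G1 v u = t)" if "u \<in> pverts G1" for u
        using that \<open>v \<in> pverts G1\<close> p1_less
        by (simp add: A1_def adjacency_matrix_def distance_graph_def n_def[symmetric] nth_p1)
      moreover have "A2 t $$ (p2 x, p2 w) = of_bool (graph_dist G2 x w = t)" if "x \<in> pverts G2" for x
        using that \<open>w \<in> pverts G2\<close> p2_less
        by (simp add: A2_def adjacency_matrix_def distance_graph_def len2 nth_p2)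
      ultimately have "(A1 t * S) $$ (p1 v, p2 w) =
          (\<Sum>u\<in>pverts G1. of_bool (graph_dist G1 v u = t) * S $$ (p1 u, p2 w))"
        "(S * A2 t) $$ (p1 v, p2 w) =
          (\<Sum>x\<in>pverts G2. S $$ (p1 v, p2 x) * of_bool (graph_dist G2 x w = t))"
        using mult_mat_index_bij_betw[OF wit(4)[of t] wit(6) p1_less p2_less p1]
          mult_mat_index_bij_betw[OF wit(6) wit(5)[of t] p1_less p2_less p2] that
        by simp_all
      then show ?thesis
        unfolding commute by (rule trans[OF sym])
    qed
  qed (use assms(1,3,7) part[OF _ bij1 p1_nth] part[OF _ bij2 p2_nth] blk p1_less p2_less p2_nth in auto)
qed

end
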